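(* Let $\mathcal{R}$ be a higher-order rewrite system (HRS) and let $(>,\sqsupset)$ be a $\beta\eta$-normal higher-order reduction order such that $\ell >^+ r$ for every rule $\ell \to r \in \mathcal{R}$ (where $>^+$ is the transitive closure of $>$). Then $\mathcal{R}$ is terminating, i.e., the rewrite relation $\to_{\mathcal{R}}$ is well-founded (there is no infinite sequence $s_1 \to_{\mathcal{R}} s_2 \to_{\mathcal{R}} \cdots$).
   Context: Simple types are built from a set $\mathcal{B}$ of base types: every $a \in \mathcal{B}$ is a type and $U \to V$ is a type for types $U,V$ ($\to$ associates to the right). For every type $U$ there is an infinite set $\mathcal{V}_U$ of variables and a set $\mathcal{F}_U$ of function symbols, all these sets pairwise disjoint; $\mathcal{V}$ and $\mathcal{F}$ denote their unions. Each $f \in \mathcal{F}$ has an arity $\mathrm{ar}(f) \in \mathbb{N}$. The sets $\Lambda_U$ of typed terms are defined by: $\mathcal{V}_U \subseteq \Lambda_U$; if $f \in \mathcal{F}_{T_1 \to \cdots \to T_{\mathrm{ar}(f)} \to U}$ and $t_i \in \Lambda_{T_i}$ then $f(t_1,\dots,t_{\mathrm{ar}(f)}) \in \Lambda_U$; if $x \in \mathcal{V}_U$, $s \in \Lambda_V$ then $\lambda x.s \in \Lambda_{U \to V}$; if $s \in \Lambda_{U\to V}$, $t \in \Lambda_U$ then $st \in \Lambda_V$. $\Lambda$ is the set of all typed terms, $\tau(s)$ the type of $s$; terms are taken modulo $\alpha$-renaming, application associates to the left. $\mathrm{FV}(s)$ is the set of free variables, $s[x/t]$ capture-avoiding substitution.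 $\beta$-reduction is $(\lambda x.s)t \to_\beta s[x/t]$ and $\eta$-reduction is $\lambda x.ux \to_\eta u$ if $x \notin \mathrm{FV}(u)$ (both closed under contexts). Every term $s$ has a unique $\beta\eta$-normal form $s{\downarrow}$; $\mathrm{NF}_{\beta\eta}$ is the set of $\beta\eta$-normal terms. A substitution $\sigma$ is a type-preserving map from variables to terms with finite domain $\{x \mid \sigma(x)\neq x\}$; $s\sigma$ is simultaneous capture-avoiding substitution and $s\sigma{\downarrow}$ means $(s\sigma){\downarrow}$. A context $C$ is a term with exactly one occurrence of a hole $\square$ (of any type); $C[s]$ replaces $\square$ by $s$ without capture-avoidance. A relation $R$ on terms is monotone if $s \mathrel{R} t$ implies $C[s] \mathrel{R} C[t]$ for all contexts $C$. A rewrite rule is a pair $\ell \to r$ with $\ell, r \in \mathrm{NF}_{\beta\eta}$, $\ell$ not of the form $x s_1 \cdots s_n$ with $x$ a variable, $\tau(\ell)=\tau(r)$ and $\mathrm{FV}(r) \subseteq \mathrm{FV}(\ell)$. An HRS is a set $\mathcal{R}$ of rewrite rules. There is a rewrite step $s \to_{\mathcal{R}} t$ if there are a rule $\ell \to r \in \mathcal{R}$, a substitution $\sigma$ and a context $C$ such that $s = C[\ell\sigma{\downarrow}] \in \mathrm{NF}_{\beta\eta}$ and $t = C[r\sigma{\downarrow}]{\downarrow}$. A $\beta\eta$-normal higher-order reduction order is a pair $(>,\sqsupset)$ of binary relations such that: $\sqsupset \subseteq \Lambda \times \Lambda$ is well-founded; $\sqsupset$ is monotone; $\to_\beta \subseteq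 \sqsupset$ and $\to_\eta \subseteq \sqsupset$; and for all $s,t \in \mathrm{NF}_{\beta\eta}$ and all substitutions $\sigma$, $s > t$ implies $s\sigma{\downarrow} \sqsupset^+ t\sigma{\downarrow}$ (transitivity of either component is not required).
   Formalization: The relation > is taken to be a relation on βη-normal terms only (otherwise chains of > through non-normal terms give a counterexample), and monotonicity of ⊐ is read for all contexts C with C[s] a typed term, so that ⊐ preserves types. *)

theory Defs
  imports Main
begin

datatype 'b ty = Base 'b | Arrow "'b ty" "'b ty"  (infixr "\<rightarrow>\<^sub>t" 65)

(* The variables of type U are {x. vtype \<Sigma> x = U}, the function symbols of type U are
   {f. ftype \<Sigma> f = U}. *)

record ('b, 'v, 'f) signature =
  vtype :: "'v \<Rightarrow> 'b ty"
  ftype :: "'f \<Rightarrow> 'b ty"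
  arity :: "'f \<Rightarrow> nat"

definition infinitely_many_vars :: "('b, 'v, 'f) signature \<Rightarrow> bool" where
  "infinitely_many_vars \<Sigma> \<longleftrightarrow> (\<forall>U. infinite {x. vtype \<Sigma> x = U})"

(* Terms modulo alpha-renaming are represented by locally nameless terms: free variables are
   named, bound ones are de Bruijn indices, and Lam \<Sigma> x s below is the alpha-class of the
   abstraction of the named variable x in s. Typing, contexts, reductions and rules are stated
   through Var, Fn, App and Lam only, and the typing rules produce no dangling indices. *)

datatype ('b, 'v, 'f) trm =
    Var 'v
  | Bound nat
  | Fn 'f "('b, 'v, 'f) trm list"
  | Abs "'b ty" "('b, 'v, 'f) trm"
  | App "('b, 'v, 'f) trm" "('b, 'v, 'f) trm"

primrec FV :: "('b, 'v, 'f) trm \<Rightarrow> 'v set" where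
  "FV (Var x) = {x}"
| "FV (Bound i) = {}"
| "FV (Fn f ts) = \<Union> (set (map FV ts))"
| "FV (Abs U s) = FV s"
| "FV (App s t) = FV s \<union> FV t"

primrec bind_var :: "'v \<Rightarrow> nat \<Rightarrow> ('b, 'v, 'f) trm \<Rightarrow> ('b, 'v, 'f) trm" where
  "bind_var x k (Var y) = (if y = x then Bound k else Var y)"
| "bind_var x k (Bound i) = Bound i"
| "bind_var x k (Fn f ts) = Fn f (map (bind_var x k) ts)"
| "bind_var x k (Abs U s) = Abs U (bind_var x (Suc k) s)"
| "bind_var x k (App s t) = App (bind_var x k s) (bind_var x k t)"

definition Lam :: "('b, 'v, 'f) signature \<Rightarrow> 'v \<Rightarrow> ('b, 'v, 'f) trm \<Rightarrow> ('b, 'v, 'f) trm" where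
  "Lam \<Sigma> x s = Abs (vtype \<Sigma> x) (bind_var x 0 s)"

(* Simultaneous substitution. It is capture-avoiding because the substituted terms have no
   dangling indices. *)

primrec subst :: "('v \<Rightarrow> ('b, 'v, 'f) trm) \<Rightarrow> ('b, 'v, 'f) trm \<Rightarrow> ('b, 'v, 'f) trm" where
  "subst \<sigma> (Var x) = \<sigma> x"
| "subst \<sigma> (Bound i) = Bound i"
| "subst \<sigma> (Fn f ts) = Fn f (map (subst \<sigma>) ts)"
| "subst \<sigma> (Abs U s) = Abs U (subst \<sigma> s)"
| "subst \<sigma> (App s t) = App (subst \<sigma> s) (subst \<sigma> t)"

lemma FV_Lam: "FV (Lam \<Sigma> x s) = FV s - {x}"
proof -
  have "FV (bind_var x k s) = FV s - {x}" for k
    by (induction s arbitrary: k) auto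
  then show ?thesis by (simp add: Lam_def)
qed

lemma Lam_rename:
  assumes "vtype \<Sigma> x = vtype \<Sigma> y" and "y \<notin> FV s"
  shows "Lam \<Sigma> x s = Lam \<Sigma> y (subst (Var(x := Var y)) s)"
proof -
  have "bind_var x k s = bind_var y k (subst (Var(x := Var y)) s)" for k
    using assms(2) by (induction s arbitrary: k) auto
  then show ?thesis using assms(1) by (simp add: Lam_def)
qed

inductive has_type ::
  "('b, 'v, 'f) signature \<Rightarrow> ('b, 'v, 'f) trm \<Rightarrow> 'b ty \<Rightarrow> bool" for \<Sigma> where
  Var: "has_type \<Sigma> (Var x) (vtype \<Sigma> x)"
| Fn: "\<lbrakk>ftype \<Sigma> f = foldr (\<rightarrow>\<^sub>t) Ts U; length Ts = arity \<Sigma> f; list_all2 (has_type \<Sigma>) ts Ts\<rbrakk>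
    \<Longrightarrow> has_type \<Sigma> (Fn f ts) U"
| Lam: "has_type \<Sigma> s V \<Longrightarrow> has_type \<Sigma> (Lam \<Sigma> x s) (vtype \<Sigma> x \<rightarrow>\<^sub>t V)"
| App: "\<lbrakk>has_type \<Sigma> s (U \<rightarrow>\<^sub>t V); has_type \<Sigma> t U\<rbrakk> \<Longrightarrow> has_type \<Sigma> (App s t) V"

definition Terms :: "('b, 'v, 'f) signature \<Rightarrow> ('b, 'v, 'f) trm set" where
  "Terms \<Sigma> = {s. \<exists>U. has_type \<Sigma> s U}"

definition substitution ::
  "('b, 'v, 'f) signature \<Rightarrow> ('v \<Rightarrow> ('b, 'v, 'f) trm) \<Rightarrow> bool" where
  "substitution \<Sigma> \<sigma> \<longleftrightarrow>
     (\<forall>x. has_type \<Sigma> (\<sigma> x) (vtype \<Sigma> x)) \<and> finite {x. \<sigma> x \<noteq> Var x}"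

(* Contexts keep the names of their binders: plugging a term below CLam x captures its free
   occurrences of x. *)

datatype ('b, 'v, 'f) ctxt =
    Hole
  | CFn 'f "('b, 'v, 'f) trm list" "('b, 'v, 'f) ctxt" "('b, 'v, 'f) trm list"
  | CLam 'v "('b, 'v, 'f) ctxt"
  | CAppL "('b, 'v, 'f) ctxt" "('b, 'v, 'f) trm"
  | CAppR "('b, 'v, 'f) trm" "('b, 'v, 'f) ctxt"

primrec plug ::
  "('b, 'v, 'f) signature \<Rightarrow> ('b, 'v, 'f) ctxt \<Rightarrow> ('b, 'v, 'f) trm \<Rightarrow> ('b, 'v, 'f) trm" where
  "plug \<Sigma> Hole s = s"
| "plug \<Sigma> (CFn f ts C us) s = Fn f (ts @ plug \<Sigma> C s # us)"
| "plug \<Sigma> (CLam x C) s = Lam \<Sigma> x (plug \<Sigma> C s)"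
| "plug \<Sigma> (CAppL C t) s = App (plug \<Sigma> C s) t"
| "plug \<Sigma> (CAppR t C) s = App t (plug \<Sigma> C s)"

(* ctxt_type \<Sigma> C H U: with a hole of type H, the context C is a term of type U. *)

inductive ctxt_type ::
  "('b, 'v, 'f) signature \<Rightarrow> ('b, 'v, 'f) ctxt \<Rightarrow> 'b ty \<Rightarrow> 'b ty \<Rightarrow> bool" for \<Sigma> where
  Hole: "ctxt_type \<Sigma> Hole H H"
| CFn: "\<lbrakk>ftype \<Sigma> f = foldr (\<rightarrow>\<^sub>t) (Ts @ T # Us) U; length (Ts @ T # Us) = arity \<Sigma> f;
     list_all2 (has_type \<Sigma>) ts Ts; ctxt_type \<Sigma> C H T; list_all2 (has_type \<Sigma>) us Us\<rbrakk>
    \<Longrightarrow> ctxt_type \<Sigma> (CFn f ts C us) H U"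
| CLam: "ctxt_type \<Sigma> C H V \<Longrightarrow> ctxt_type \<Sigma> (CLam x C) H (vtype \<Sigma> x \<rightarrow>\<^sub>t V)"
| CAppL: "\<lbrakk>ctxt_type \<Sigma> C H (U \<rightarrow>\<^sub>t V); has_type \<Sigma> t U\<rbrakk> \<Longrightarrow> ctxt_type \<Sigma> (CAppL C t) H V"
| CAppR: "\<lbrakk>has_type \<Sigma> s (U \<rightarrow>\<^sub>t V); ctxt_type \<Sigma> C H U\<rbrakk> \<Longrightarrow> ctxt_type \<Sigma> (CAppR s C) H V"

definition ctxt_closure ::
  "('b, 'v, 'f) signature \<Rightarrow> ('b, 'v, 'f) trm rel \<Rightarrow> ('b, 'v, 'f) trm rel" where
  "ctxt_closure \<Sigma> R = {(plug \<Sigma> C s, plug \<Sigma> C t) | C s t H U.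
     (s, t) \<in> R \<and> has_type \<Sigma> s H \<and> ctxt_type \<Sigma> C H U}"

(* C ranges over the contexts for which C[s] is a term. For a relation on Terms \<Sigma> the condition
   thus includes that C[t] is a term, i.e. that s and t have the same type. *)

definition monotone_rel :: "('b, 'v, 'f) signature \<Rightarrow> ('b, 'v, 'f) trm rel \<Rightarrow> bool" where
  "monotone_rel \<Sigma> R \<longleftrightarrow> (\<forall>s t C H U. (s, t) \<in> R \<and> has_type \<Sigma> s H \<and> ctxt_type \<Sigma> C H U
     \<longrightarrow> (plug \<Sigma> C s, plug \<Sigma> C t) \<in> R)"

definition beta :: "('b, 'v, 'f) signature \<Rightarrow> ('b, 'v, 'f) trm rel" where
  "beta \<Sigma> = ctxt_closure \<Sigma> {(App (Lam \<Sigma> x s) t, subst (Var(x := t)) s) | x s t.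
     s \<in> Terms \<Sigma> \<and> t \<in> Terms \<Sigma>}"

definition eta :: "('b, 'v, 'f) signature \<Rightarrow> ('b, 'v, 'f) trm rel" where
  "eta \<Sigma> = ctxt_closure \<Sigma> {(Lam \<Sigma> x (App u (Var x)), u) | x u.
     u \<in> Terms \<Sigma> \<and> x \<notin> FV u}"

definition NF :: "('b, 'v, 'f) signature \<Rightarrow> ('b, 'v, 'f) trm set" where
  "NF \<Sigma> = {s \<in> Terms \<Sigma>. \<nexists>t. (s, t) \<in> beta \<Sigma> \<union> eta \<Sigma>}"

(* Normal forms of typed terms exist and are unique, so the choice is immaterial. *)

definition nf :: "('b, 'v, 'f) signature \<Rightarrow> ('b, 'v, 'f) trm \<Rightarrow> ('b, 'v, 'f) trm" where
  "nf \<Sigma> s = (SOME t. (s, t) \<in> (beta \<Sigma> \<union> eta \<Sigma>)\<^sup>* \<and> t \<in> NF \<Sigma>)"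

definition rewrite_rule ::
  "('b, 'v, 'f) signature \<Rightarrow> ('b, 'v, 'f) trm \<Rightarrow> ('b, 'v, 'f) trm \<Rightarrow> bool" where
  "rewrite_rule \<Sigma> l r \<longleftrightarrow> l \<in> NF \<Sigma> \<and> r \<in> NF \<Sigma> \<and>
     (\<nexists>x ss. l = foldl App (Var x) ss) \<and>
     (\<exists>U. has_type \<Sigma> l U \<and> has_type \<Sigma> r U) \<and> FV r \<subseteq> FV l"

definition HRS :: "('b, 'v, 'f) signature \<Rightarrow> ('b, 'v, 'f) trm rel \<Rightarrow> bool" where
  "HRS \<Sigma> R \<longleftrightarrow> (\<forall>(l, r) \<in> R. rewrite_rule \<Sigma> l r)"

definition rstep ::
  "('b, 'v, 'f) signature \<Rightarrow> ('b, 'v, 'f) trm rel \<Rightarrow> ('b, 'v, 'f) trm rel" where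
  "rstep \<Sigma> R = {(s, t). \<exists>l r \<sigma> C H U. (l, r) \<in> R \<and> substitution \<Sigma> \<sigma> \<and>
     has_type \<Sigma> (nf \<Sigma> (subst \<sigma> l)) H \<and> ctxt_type \<Sigma> C H U \<and>
     s = plug \<Sigma> C (nf \<Sigma> (subst \<sigma> l)) \<and> s \<in> NF \<Sigma> \<and>
     t = nf \<Sigma> (plug \<Sigma> C (nf \<Sigma> (subst \<sigma> r)))}"

(* The first component is a relation on normal forms: the last condition says nothing about
   pairs involving other terms, which could otherwise be intermediate terms of its
   transitive closure. *)

definition normal_ho_reduction_order ::
  "('b, 'v, 'f) signature \<Rightarrow> ('b, 'v, 'f) trm rel \<Rightarrow> ('b, 'v, 'f) trm rel \<Rightarrow> bool" where
  "normal_ho_reduction_order \<Sigma> gt sq \<longleftrightarrow>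
     gt \<subseteq> NF \<Sigma> \<times> NF \<Sigma> \<and>
     sq \<subseteq> Terms \<Sigma> \<times> Terms \<Sigma> \<and>
     wf (sq\<inverse>) \<and>
     monotone_rel \<Sigma> sq \<and>
     beta \<Sigma> \<subseteq> sq \<and>
     eta \<Sigma> \<subseteq> sq \<and>
     (\<forall>s\<in>NF \<Sigma>. \<forall>t\<in>NF \<Sigma>. \<forall>\<sigma>. substitution \<Sigma> \<sigma> \<longrightarrow> (s, t) \<in> gt \<longrightarrow>
        (nf \<Sigma> (subst \<sigma> s), nf \<Sigma> (subst \<sigma> t)) \<in> sq\<^sup>+)"

end

theory Submission
  imports Defs
begin

text \<open>
  A rewrite step \<open>C[l\<sigma>\<down>] \<rightarrow> C[r\<sigma>\<down>]\<down>\<close> is contained in \<open>\<sqsupset>\<^sup>+\<close>: stability maps the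
  chain \<open>l > \<dots> > r\<close> to \<open>l\<sigma>\<down> \<sqsupset>\<^sup>+ r\<sigma>\<down>\<close>, monotonicity puts it into \<open>C\<close>, and the final
  normalisation consists of \<open>\<beta>\<eta>\<close>-steps, which are \<open>\<sqsupset>\<close>-steps. Well-foundedness of \<open>\<sqsupset>\<close>
  supplies the existence of normal forms, and their uniqueness plays no role.
\<close>

lemma has_type_Var_iff: "has_type \<Sigma> (Var x) U \<longleftrightarrow> U = vtype \<Sigma> x"
proof
  assume "has_type \<Sigma> (Var x) U"
  then show "U = vtype \<Sigma> x"
    \<comment> \<open>\<open>Lam\<close> is not a constructor; unfolding it to \<open>Abs\<close>
      lets distinctness of constructors discard the abstraction rule.\<close>
    by (cases rule: has_type.cases) (simp_all add: Lam_def)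
qed (simp add: has_type.Var)

lemma has_type_App_iff:
  "has_type \<Sigma> (App s t) V \<longleftrightarrow> (\<exists>U. has_type \<Sigma> s (U \<rightarrow>\<^sub>t V) \<and> has_type \<Sigma> t U)"
proof
  assume "has_type \<Sigma> (App s t) V"
  then show "\<exists>U. has_type \<Sigma> s (U \<rightarrow>\<^sub>t V) \<and> has_type \<Sigma> t U"
    by (cases rule: has_type.cases) (auto simp: Lam_def)
qed (blast intro: has_type.App)

text \<open>
  The context \<open>x \<box>\<close> with a variable \<open>x : H \<rightarrow> H\<close> turns monotonicity, which only says that
  plugging yields terms, into preservation of types.
\<close>

lemma monotone_rel_preserves_type:
  assumes vars: "infinitely_many_vars \<Sigma>"
    and mono: "monotone_rel \<Sigma> R"
    and terms: "R \<subseteq> Terms \<Sigma> \<times> Terms \<Sigma>"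
    and st: "(s, t) \<in> R" and s: "has_type \<Sigma> s H"
  shows "has_type \<Sigma> t H"
proof -
  have "infinite {x. vtype \<Sigma> x = H \<rightarrow>\<^sub>t H}"
    using vars by (simp add: infinitely_many_vars_def)
  then have "{x. vtype \<Sigma> x = H \<rightarrow>\<^sub>t H} \<noteq> {}"
    by (metis finite.emptyI)
  then obtain x where x: "vtype \<Sigma> x = H \<rightarrow>\<^sub>t H"
    by blast
  have "ctxt_type \<Sigma> (CAppR (Var x) Hole) H H"
    by (rule ctxt_type.CAppR[where U = H])
      (simp_all add: has_type_Var_iff x ctxt_type.Hole)
  then have "(plug \<Sigma> (CAppR (Var x) Hole) s, plug \<Sigma> (CAppR (Var x) Hole) t) \<in> R"
    using mono st s unfolding monotone_rel_def by blast
  then obtain V where "has_type \<Sigma> (App (Var x) t) V"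
    using terms by (auto simp: Terms_def)
  then show ?thesis
    by (auto simp: has_type_App_iff has_type_Var_iff x)
qed

text \<open>Monotonicity applies to a link only if its source fits the hole, so the type
  \<open>H\<close> has to be carried along the chain.\<close>

lemma monotone_rel_trancl:
  assumes "infinitely_many_vars \<Sigma>"
    and mono: "monotone_rel \<Sigma> R"
    and "R \<subseteq> Terms \<Sigma> \<times> Terms \<Sigma>"
  shows "monotone_rel \<Sigma> (R\<^sup>+)"
proof -
  have "(plug \<Sigma> C s, plug \<Sigma> C t) \<in> R\<^sup>+"
    if "(s, t) \<in> R\<^sup>+" and "has_type \<Sigma> s H" and C: "ctxt_type \<Sigma> C H U" for s t C H U
    using that(1,2)
  \<comment> \<open>Peeling off the first link fits the typing assumption, which concerns the left
    end.\<close>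
  proof (induction rule: converse_trancl_induct)
    case (base s)
    then show ?case using mono C unfolding monotone_rel_def by blast
  next
    case (step s s')
    have "(plug \<Sigma> C s, plug \<Sigma> C s') \<in> R"
      using mono C step.hyps(1) step.prems unfolding monotone_rel_def by blast
    moreover have "has_type \<Sigma> s' H"
      using monotone_rel_preserves_type[OF assms step.hyps(1) step.prems] .
    ultimately show ?case
      using step.IH by (blast intro: trancl_into_trancl2)
  qed
  then show ?thesis unfolding monotone_rel_def by blast
qed

text \<open>As \<open>nf\<close> is a choice, it is reachable once some normal form is: a term
  outside \<open>NF\<close> has a reduct, which is typed and smaller along \<open>R\<close>.\<close>

lemma nf_reachable:
  assumes wf: "wf (R\<inverse>)" and sub: "beta \<Sigma> \<union> eta \<Sigma> \<subseteq> R"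
    and terms: "R \<subseteq> Terms \<Sigma> \<times> Terms \<Sigma>"
    and "s \<in> Terms \<Sigma>"
  shows "(s, nf \<Sigma> s) \<in> (beta \<Sigma> \<union> eta \<Sigma>)\<^sup>*"
proof -
  have "\<exists>t. (s, t) \<in> (beta \<Sigma> \<union> eta \<Sigma>)\<^sup>* \<and> t \<in> NF \<Sigma>"
    using wf \<open>s \<in> Terms \<Sigma>\<close>
  proof (induction s rule: wf_induct_rule)
    case (less s)
    show ?case
    proof (cases "s \<in> NF \<Sigma>")
      case False
      then obtain s' where s': "(s, s') \<in> beta \<Sigma> \<union> eta \<Sigma>"
        using less.prems unfolding NF_def by blast
      with sub terms have "(s', s) \<in> R\<inverse>" and "s' \<in> Terms \<Sigma>"
        by blast+
      from less.IH[OF this] s' show ?thesis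
        by (meson converse_rtrancl_into_rtrancl)
    qed blast
  qed
  then show ?thesis
    unfolding nf_def by (rule someI2_ex) blast
qed

lemma normal_ho_reduction_order_stable_trancl:
  assumes ord: "normal_ho_reduction_order \<Sigma> gt sq"
    and \<sigma>: "substitution \<Sigma> \<sigma>" and "(s, t) \<in> gt\<^sup>+"
  shows "(nf \<Sigma> (subst \<sigma> s), nf \<Sigma> (subst \<sigma> t)) \<in> sq\<^sup>+"
proof -
  \<comment> \<open>The order relates only normal forms, so stability also covers the intermediate
    terms of the chain.\<close>
  have stable: "(nf \<Sigma> (subst \<sigma> s), nf \<Sigma> (subst \<sigma> t)) \<in> sq\<^sup>+" if "(s, t) \<in> gt" for s t
    using ord \<sigma> that unfolding normal_ho_reduction_order_def by blast
  from \<open>(s, t) \<in> gt\<^sup>+\<close> show ?thesis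
  proof (induction rule: trancl_induct)
    case (base t)
    then show ?case by (rule stable)
  next
    case (step t u)
    show ?case by (rule trancl_trans[OF step.IH stable[OF step.hyps(2)]])
  qed
qed

lemma rstep_subset_trancl:
  assumes vars: "infinitely_many_vars \<Sigma>"
    and ord: "normal_ho_reduction_order \<Sigma> gt sq"
    and rules: "R \<subseteq> gt\<^sup>+"
  shows "rstep \<Sigma> R \<subseteq> sq\<^sup>+"
proof (rule subrelI)
  fix s t
  assume "(s, t) \<in> rstep \<Sigma> R"
  then obtain l r \<sigma> C H U where lr: "(l, r) \<in> R" and \<sigma>: "substitution \<Sigma> \<sigma>"
    and l: "has_type \<Sigma> (nf \<Sigma> (subst \<sigma> l)) H" and C: "ctxt_type \<Sigma> C H U"
    and s: "s = plug \<Sigma> C (nf \<Sigma> (subst \<sigma> l))"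
    and t: "t = nf \<Sigma> (plug \<Sigma> C (nf \<Sigma> (subst \<sigma> r)))"
    unfolding rstep_def by blast
  let ?t = "plug \<Sigma> C (nf \<Sigma> (subst \<sigma> r))"
  from ord have terms: "sq \<subseteq> Terms \<Sigma> \<times> Terms \<Sigma>" and wf: "wf (sq\<inverse>)"
    and mono: "monotone_rel \<Sigma> sq" and sub: "beta \<Sigma> \<union> eta \<Sigma> \<subseteq> sq"
    unfolding normal_ho_reduction_order_def by blast+
  have "(nf \<Sigma> (subst \<sigma> l), nf \<Sigma> (subst \<sigma> r)) \<in> sq\<^sup>+"
    using normal_ho_reduction_order_stable_trancl[OF ord \<sigma>] lr rules by blast
  then have st: "(s, ?t) \<in> sq\<^sup>+"
    using monotone_rel_trancl[OF vars mono terms] l C s unfolding monotone_rel_def by blast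
  \<comment> \<open>Being the target of a chain of typed terms makes \<open>?t\<close> a term, so
    its normal form can be reached.\<close>
  then have "?t \<in> Terms \<Sigma>"
    using trancl_subset_Sigma[OF terms] by blast
  then have "(?t, t) \<in> sq\<^sup>*"
    using nf_reachable[OF wf sub terms] rtrancl_mono[OF sub] t by blast
  \<comment> \<open>The normalisation may be empty, but the part before it has at least one
    step.\<close>
  with st show "(s, t) \<in> sq\<^sup>+"
    by (rule trancl_rtrancl_trancl)
qed

theorem theorem1:
  fixes \<Sigma> :: "('b, 'v, 'f) signature"
    and R gt sq :: "('b, 'v, 'f) trm rel"
  assumes "infinitely_many_vars \<Sigma>"
    and "HRS \<Sigma> R"
    and "normal_ho_reduction_order \<Sigma> gt sq"
    and "\<forall>(l, r) \<in> R. (l, r) \<in> gt\<^sup>+"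
  shows "wf ((rstep \<Sigma> R)\<inverse>)"
proof (rule wf_subset)
  have "wf (sq\<inverse>)"
    using assms(3) by (simp add: normal_ho_reduction_order_def)
  \<comment> \<open>Converse commutes with transitive closure, which preserves
    well-foundedness.\<close>
  then show "wf ((sq\<^sup>+)\<inverse>)"
    by (simp add: wf_trancl flip: trancl_converse)
  have "R \<subseteq> gt\<^sup>+"
    using assms(4) by auto
  then show "(rstep \<Sigma> R)\<inverse> \<subseteq> (sq\<^sup>+)\<inverse>"
    using rstep_subset_trancl[OF assms(1,3)] by (simp only: converse_mono)
qed

end
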